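(* Let $A \in \mathbb{R}^{m \times n}$ be a real matrix all of whose rows and columns are nonzero, let $\hat b \in \mathbb{R}^m$, and let $\alpha,\omega \in (0,2)$. Then, for any starting vector $x^0 \in \mathbb{R}^n$, every sequence $(x^k)_{k\in\mathbb{N}}$ generated by the Almost Cyclic Extended Kaczmarz (ACEK) algorithm with parameters $\alpha,\omega$ converges to a least-squares solution, i.e. to an element of $LSS(A;\hat b)$.
   Context: Notation: $[q]=\{1,\dots,q\}$; $\langle\cdot,\cdot\rangle$ is the Euclidean inner product and $\|\cdot\|$ the Euclidean norm; $A_i$ denotes the $i$-th row of $A$ (as a vector in $\mathbb{R}^n$) and $A^j$ the $j$-th column of $A$ (a vector in $\mathbb{R}^m$); $\hat b^k_i$ denotes the $i$-th component of the vector $\hat b^k$. $\mathcal{R}(A)$ is the range of $A$, and $P_{\mathcal{R}(A)}$ is the orthogonal projector onto $\mathcal{R}(A)$. Least-squares solution set: $LSS(A;\hat b) = \{x \in \mathbb{R}^n : Ax = P_{\mathcal{R}(A)}(\hat b)\}$, equivalently the set of minimizers of $\|Ax-\hat b\|$. The system $Ax=\hat b$ may be inconsistent. Almost cyclic control: index sequences $(i_k)$ in $[m]$ and $(j_k)$ in $[n]$ are almost cyclic if there exist integers $m_0, n_0$ such that, for every $k \in \mathbb{N}$, $[m] \subseteq \{i_{k+1},\dots,i_{k+m_0}\}$ and $[n] \subseteq \{j_{k+1},\dots,j_{k+n_0}\}$. ACEK algorithm: start with an arbitrary $x^0 \in \mathbb{R}^n$ and $y^0 = \hat b$, with $(i_k)$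 and $(j_k)$ almost cyclic. For $k = 1,2,3,\dots$ (run indefinitely): 1. set $y^k = y^{k-1} - \alpha\, \dfrac{\langle y^{k-1}, A^{j_k}\rangle}{\|A^{j_k}\|^2}\, A^{j_k}$; 2. set $\hat b^k = \hat b - y^k$; 3. set $x^k = x^{k-1} - \omega\, \dfrac{\langle x^{k-1}, A_{i_k}\rangle - \hat b^k_{i_k}}{\|A_{i_k}\|^2}\, A_{i_k}$. *)

theory Defs
  imports "HOL-Analysis.Analysis"
begin

definition orth_proj :: "'a::euclidean_space set \<Rightarrow> 'a \<Rightarrow> 'a" where
  "orth_proj S b = (THE p. p \<in> S \<and> b - p \<in> S\<^sup>\<bottom>)"

lemma orth_proj_ex1:
  fixes S :: "'a::euclidean_space set"
  assumes "subspace S"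
  shows "\<exists>!p. p \<in> S \<and> b - p \<in> S\<^sup>\<bottom>"
proof (rule ex_ex1I)
  obtain p z where p: "p \<in> span S" and z: "\<And>w. w \<in> span S \<Longrightarrow> orthogonal z w"
    and b: "b = p + z"
    using orthogonal_subspace_decomp_exists[of S b] by metis
  have eq: "span S = S" using assms by (simp add: span_eq_iff)
  show "\<exists>p. p \<in> S \<and> b - p \<in> S\<^sup>\<bottom>"
    using p[unfolded eq] z[unfolded eq] b by (intro exI[of _ p]) (auto simp: orthogonal_comp_def orthogonal_commute)
next
  fix p q
  assume p: "p \<in> S \<and> b - p \<in> S\<^sup>\<bottom>" and q: "q \<in> S \<and> b - q \<in> S\<^sup>\<bottom>"
  have d: "p - q \<in> S" using p q assms by (simp add: subspace_diff)
  have "(p - q) \<bullet> (b - p) = 0" "(p - q) \<bullet> (b - q) = 0"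
    using p q d by (auto simp: orthogonal_comp_def orthogonal_def)
  then have "(p - q) \<bullet> (p - q) = 0" by (simp add: inner_diff_right)
  then show "p = q" by simp
qed

lemma orth_proj:
  fixes S :: "'a::euclidean_space set"
  assumes "subspace S"
  shows "orth_proj S b \<in> S" and "b - orth_proj S b \<in> S\<^sup>\<bottom>"
  using theI'[OF orth_proj_ex1[OF assms, of b]] by (auto simp: orth_proj_def)

definition LSS :: "real^'n^'m \<Rightarrow> real^'m \<Rightarrow> (real^'n) set" where
  "LSS A b = {x. A *v x = orth_proj (range ((*v) A)) b}"

lemma LSS_eq_minimizers:
  fixes A :: "real^'n^'m"
  shows "LSS A b = {x. \<forall>z. norm (A *v x - b) \<le> norm (A *v z - b)}"
proof -
  let ?S = "range ((*v) A)" and ?p = "orth_proj (range ((*v) A)) b"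
  have sub: "subspace ?S"
    by (simp add: linear_subspace_image)
  have pyth: "(norm (A *v z - b))\<^sup>2 = (norm (A *v z - ?p))\<^sup>2 + (norm (?p - b))\<^sup>2" for z
  proof -
    have "A *v z - ?p \<in> ?S" using orth_proj(1)[OF sub] sub by (intro subspace_diff) auto
    then have "(A *v z - ?p) \<bullet> (b - ?p) = 0"
      using orth_proj(2)[OF sub, of b] by (auto simp: orthogonal_comp_def orthogonal_def)
    then have "orthogonal (A *v z - ?p) (?p - b)"
      by (simp add: orthogonal_def inner_diff_right)
    from norm_add_Pythagorean[OF this] show ?thesis by simp
  qed
  obtain w where w: "A *v w = ?p" using orth_proj(1)[OF sub, of b] by (metis imageE)
  show ?thesis
  proof (intro set_eqI iffI)
    fix x assume "x \<in> LSS A b"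
    then have "A *v x = ?p" by (simp add: LSS_def)
    then have "(norm (A *v x - b))\<^sup>2 \<le> (norm (A *v z - b))\<^sup>2" for z
      using pyth[of z] by simp
    then show "x \<in> {x. \<forall>z. norm (A *v x - b) \<le> norm (A *v z - b)}"
      by (auto intro: power2_le_imp_le)
  next
    fix x assume "x \<in> {x. \<forall>z. norm (A *v x - b) \<le> norm (A *v z - b)}"
    then have "(norm (A *v x - b))\<^sup>2 \<le> (norm (A *v w - b))\<^sup>2"
      by (auto intro: power_mono)
    then have "(norm (A *v x - ?p))\<^sup>2 \<le> 0" using pyth[of x] w by simp
    then show "x \<in> LSS A b" by (simp add: LSS_def)
  qed
qed

(* The value s 0 is irrelevant: control sequences are indexed from 1. *)
definition almost_cyclic :: "(nat \<Rightarrow> 'a::finite) \<Rightarrow> bool" where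
  "almost_cyclic s \<longleftrightarrow> (\<exists>N. \<forall>k. UNIV \<subseteq> s ` {k + 1..k + N})"

(* x, y and bh are the sequences of iterates x^k, y^k and b-hat^k; the entry bh 0 is
   not used by the algorithm and is left unconstrained. *)
definition ACEK ::
  "real^'n^'m \<Rightarrow> real^'m \<Rightarrow> real \<Rightarrow> real \<Rightarrow> (nat \<Rightarrow> 'm) \<Rightarrow> (nat \<Rightarrow> 'n) \<Rightarrow> real^'n \<Rightarrow>
   (nat \<Rightarrow> real^'n) \<Rightarrow> (nat \<Rightarrow> real^'m) \<Rightarrow> (nat \<Rightarrow> real^'m) \<Rightarrow> bool"
where
  "ACEK A b \<alpha> \<omega> i j x0 x y bh \<longleftrightarrow>
     almost_cyclic i \<and> almost_cyclic j \<and>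
     x 0 = x0 \<and> y 0 = b \<and>
     (\<forall>k\<ge>1.
        y k = y (k - 1)
          - (\<alpha> * ((y (k - 1) \<bullet> column (j k) A) / (norm (column (j k) A))\<^sup>2)) *\<^sub>R column (j k) A \<and>
        bh k = b - y k \<and>
        x k = x (k - 1)
          - (\<omega> * ((x (k - 1) \<bullet> row (i k) A - bh k $ i k) / (norm (row (i k) A))\<^sup>2)) *\<^sub>R row (i k) A)"

end

theory Submission
  imports Defs
begin

text \<open>
  Over one block of an almost cyclic control, the relaxed projections onto the hyperplanes
  orthogonal to the vectors \<open>v i\<close> contract the span of these vectors by a factor below 1 that does
  not depend on the block. Hence an iteration of such projections, perturbed by errors in the span
  that tend to 0, tends to 0. For the columns of \<open>A\<close> and without errors, this shows that \<open>y\<close>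
  converges to the component of \<open>b\<close> orthogonal to the range of \<open>A\<close>. If \<open>xs\<close> is the least-squares
  solution for which \<open>x0 - xs\<close> lies in the row space, then \<open>x - xs\<close> is such an iteration for the
  rows of \<open>A\<close>, whose errors are bounded by the distance of \<open>y\<close> to its limit.
\<close>

section \<open>Relaxed projections onto hyperplanes through the origin\<close>

definition relaxed_proj :: "real \<Rightarrow> 'a::real_inner \<Rightarrow> 'a \<Rightarrow> 'a" where
  "relaxed_proj \<omega> v z = z - (\<omega> * ((z \<bullet> v) / (norm v)\<^sup>2)) *\<^sub>R v"

lemma relaxed_proj_diff:
  "relaxed_proj \<omega> v (z - w) = relaxed_proj \<omega> v z - relaxed_proj \<omega> v w"
  unfolding relaxed_proj_def inner_diff_left diff_divide_distrib right_diff_distrib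
    scaleR_left_diff_distrib by simp

lemma relaxed_proj_in_subspace:
  assumes "subspace S" "v \<in> S" "z \<in> S"
  shows "relaxed_proj \<omega> v z \<in> S"
  using assms by (simp add: relaxed_proj_def subspace_diff subspace_scale)

lemma norm_relaxed_proj_step:
  "norm (relaxed_proj \<omega> v z - z) = \<bar>\<omega>\<bar> * (\<bar>z \<bullet> v\<bar> / norm v)"
  by (simp add: relaxed_proj_def abs_mult power2_eq_square)

text \<open>The loss of squared norm is proportional to the squared step length. For \<omega> in
  (0,2) this gives nonexpansiveness and also forces short steps where the norm barely drops.\<close>

lemma norm_relaxed_proj_decrease:
  "\<omega> * ((norm z)\<^sup>2 - (norm (relaxed_proj \<omega> v z))\<^sup>2)
    = (2 - \<omega>) * (norm (relaxed_proj \<omega> v z - z))\<^sup>2"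
proof -
  define c where "c = \<omega> * ((z \<bullet> v) / (norm v)\<^sup>2)"
  have T: "relaxed_proj \<omega> v z = z - c *\<^sub>R v" by (simp add: relaxed_proj_def c_def)
  have c: "\<omega> * (z \<bullet> v) = c * (v \<bullet> v)"
    by (cases "v = 0") (simp_all add: c_def power2_norm_eq_inner)
  have "\<omega> * ((norm z)\<^sup>2 - (norm (z - c *\<^sub>R v))\<^sup>2) = 2 * c * (\<omega> * (z \<bullet> v)) - \<omega> * c\<^sup>2 * (v \<bullet> v)"
    unfolding power2_norm_eq_inner
    by (simp add: inner_commute power2_eq_square algebra_simps)
  also have "\<dots> = (2 - \<omega>) * (norm (z - c *\<^sub>R v - z))\<^sup>2"
  proof -
    have "(norm (z - c *\<^sub>R v - z))\<^sup>2 = c\<^sup>2 * (v \<bullet> v)"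
      by (simp add: power_mult_distrib power2_norm_eq_inner)
    then show ?thesis unfolding c by (simp add: power2_eq_square algebra_simps)
  qed
  finally show ?thesis unfolding T .
qed

lemma norm_relaxed_proj_le:
  assumes "0 < \<omega>" "\<omega> < 2"
  shows "norm (relaxed_proj \<omega> v z) \<le> norm z"
proof -
  have "0 \<le> \<omega> * ((norm z)\<^sup>2 - (norm (relaxed_proj \<omega> v z))\<^sup>2)"
    unfolding norm_relaxed_proj_decrease using assms by simp
  then have "(norm (relaxed_proj \<omega> v z))\<^sup>2 \<le> (norm z)\<^sup>2"
    using assms by (simp add: zero_le_mult_iff)
  then show ?thesis by (rule power2_le_imp_le) simp
qed

section \<open>Contraction over one block of the control\<close>

text \<open>A vector of the span orthogonal to all generators is orthogonal to itself, so the map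
  \<open>?f\<close> is injective on the span. In finite dimension it is therefore bounded below
  there.\<close>

lemma norm_le_inner_spanning_family:
  fixes v :: "'i::finite \<Rightarrow> 'a::euclidean_space"
  obtains e where "0 < e" "\<And>z. z \<in> span (range v) \<Longrightarrow> e * norm z \<le> (\<Sum>i\<in>UNIV. \<bar>z \<bullet> v i\<bar>)"
proof -
  let ?f = "\<lambda>z. \<chi> i. z \<bullet> v i"
  have lin: "bounded_linear ?f"
    by (auto intro!: linear_conv_bounded_linear[THEN iffD1] linearI
        simp: vec_eq_iff inner_add_left)
  have inj: "z = 0" if "z \<in> span (range v)" "?f z = 0" for z
  proof -
    have "orthogonal z z"
      by (rule orthogonal_to_span[OF that(1)]) (use that(2) in \<open>auto simp: orthogonal_def vec_eq_iff\<close>)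
    then show ?thesis by (simp add: orthogonal_def)
  qed
  obtain e where "0 < e" and e: "\<forall>z\<in>span (range v). e * norm z \<le> norm (?f z)"
    using injective_imp_isometric[OF closed_span subspace_span lin] inj by (metis mult.commute)
  have "e * norm z \<le> (\<Sum>i\<in>UNIV. \<bar>z \<bullet> v i\<bar>)" if "z \<in> span (range v)" for z
    using e that norm_le_l1_cart[of "?f z"] by fastforce
  with \<open>0 < e\<close> show ?thesis by (rule that)
qed

text \<open>If the norm hardly drops over the block, every step is short, so \<open>z 0\<close> is
  nearly orthogonal to each \<open>v i\<close> and must itself be small. The factor \<open>q\<close>
  is fixed before \<open>s\<close> and \<open>z\<close>, so it serves all blocks of length
  \<open>N\<close>.\<close>

lemma relaxed_proj_block_contraction:
  fixes v :: "'i::finite \<Rightarrow> 'a::euclidean_space"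
  assumes \<omega>: "0 < \<omega>" "\<omega> < 2"
  obtains q where "0 \<le> q" "q < 1"
    "\<And>s z. \<lbrakk>UNIV \<subseteq> s ` {..<N}; z 0 \<in> span (range v);
        \<And>k. z (Suc k) = relaxed_proj \<omega> (v (s k)) (z k)\<rbrakk> \<Longrightarrow> norm (z N) \<le> q * norm (z 0)"
proof -
  obtain e where e: "0 < e" "\<And>z. z \<in> span (range v) \<Longrightarrow> e * norm z \<le> (\<Sum>i\<in>UNIV. \<bar>z \<bullet> v i\<bar>)"
    using norm_le_inner_spanning_family[of v] by blast
  \<comment> \<open>\<open>C\<close> bounds a step relative to the loss \<delta> below, and
    \<open>D\<close> sums the bounds of \<open>comp\<close>. The goal is e^2 |z 0|^2 <= D^2 (|z 0|^2
    - |z N|^2), which suggests the factor 1 - e^2/D^2; the weaker D^2/(D^2 + e^2) lies in [0,1) for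
    every \<open>D\<close>.\<close>
  define C where "C = sqrt (\<omega> / (2 - \<omega>))"
  define D where "D = (\<Sum>i\<in>UNIV. (real N * C + C / \<omega>) * norm (v i))"
  define q where "q = sqrt (D\<^sup>2 / (D\<^sup>2 + e\<^sup>2))"
  have pos: "D\<^sup>2 + e\<^sup>2 > 0" using e(1) by (simp add: add_nonneg_pos)
  have "C \<ge> 0" using \<omega> by (simp add: C_def)
  have "norm (z N) \<le> q * norm (z 0)"
    if cover: "UNIV \<subseteq> s ` {..<N}" and z0: "z 0 \<in> span (range v)"
      and z: "\<And>k. z (Suc k) = relaxed_proj \<omega> (v (s k)) (z k)" for s and z :: "nat \<Rightarrow> 'a"
  proof -
    define \<delta> where "\<delta> = sqrt ((norm (z 0))\<^sup>2 - (norm (z N))\<^sup>2)"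
    have dec: "antimono (\<lambda>k. norm (z k))"
      unfolding antimono_iff_le_Suc z using norm_relaxed_proj_le[OF \<omega>] by blast
    then have mono: "(norm (z l))\<^sup>2 \<le> (norm (z k))\<^sup>2" if "k \<le> l" for k l
      using that by (auto simp: antimono_def intro: power_mono)
    have "\<delta> \<ge> 0" and \<delta>2: "\<delta>\<^sup>2 = (norm (z 0))\<^sup>2 - (norm (z N))\<^sup>2"
      using mono[of 0 N] by (simp_all add: \<delta>_def)
    have step: "norm (z (Suc k) - z k) \<le> C * \<delta>" if "k < N" for k
    proof -
      have "(2 - \<omega>) * (norm (z (Suc k) - z k))\<^sup>2
          = \<omega> * ((norm (z k))\<^sup>2 - (norm (z (Suc k)))\<^sup>2)"
        unfolding z norm_relaxed_proj_decrease ..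
      also have "\<dots> \<le> \<omega> * \<delta>\<^sup>2"
        unfolding \<delta>2 using \<omega> mono[of 0 k] mono[of "Suc k" N] that by (intro mult_left_mono diff_mono) simp_all
      finally have "(norm (z (Suc k) - z k))\<^sup>2 \<le> (C * \<delta>)\<^sup>2"
        using \<omega> by (simp add: C_def power_mult_distrib field_simps)
      then show ?thesis by (rule power2_le_imp_le) (simp add: \<open>C \<ge> 0\<close> \<open>\<delta> \<ge> 0\<close>)
    qed
    have dist: "norm (z k - z 0) \<le> real k * (C * \<delta>)" if "k \<le> N" for k
      using that
    proof (induction k)
      case (Suc k)
      have "norm (z (Suc k) - z 0) \<le> norm (z (Suc k) - z k) + norm (z k - z 0)"
        using norm_triangle_ineq[of "z (Suc k) - z k" "z k - z 0"] by simp
      also have "\<dots> \<le> C * \<delta> + real k * (C * \<delta>)"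
        using Suc step[of k] by (intro add_mono) auto
      finally show ?case by (simp add: algebra_simps)
    qed simp
    \<comment> \<open>At a step \<open>k\<close> of the block that uses \<open>v i\<close>, the step
      length measures the inner product of \<open>z k\<close> with \<open>v i\<close>;
      \<open>dist\<close> carries the estimate back to \<open>z 0\<close>.\<close>
    have comp: "\<bar>z 0 \<bullet> v i\<bar> \<le> (real N * C + C / \<omega>) * norm (v i) * \<delta>" for i
    proof -
      obtain k where k: "k < N" "s k = i" using cover by (metis UNIV_I imageE lessThan_iff subsetD)
      have "\<omega> * (\<bar>z k \<bullet> v i\<bar> / norm (v i)) \<le> C * \<delta>"
        using step[OF k(1)] \<omega> unfolding z norm_relaxed_proj_step k(2) by simp
      then have "\<bar>z k \<bullet> v i\<bar> \<le> C / \<omega> * \<delta> * norm (v i)"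
        using \<omega> by (cases "v i = 0") (simp_all add: field_simps)
      moreover have "\<bar>(z k - z 0) \<bullet> v i\<bar> \<le> real N * (C * \<delta>) * norm (v i)"
      proof -
        have "norm (z k - z 0) \<le> real N * (C * \<delta>)"
          using dist[of k] k \<open>C \<ge> 0\<close> \<open>\<delta> \<ge> 0\<close>
          by (meson less_imp_le mult_nonneg_nonneg mult_right_mono of_nat_mono order_trans)
        then show ?thesis
          using Cauchy_Schwarz_ineq2[of "z k - z 0" "v i"] by (meson mult_right_mono norm_ge_zero order_trans)
      qed
      ultimately show ?thesis by (simp add: inner_diff_left algebra_simps)
    qed
    have "e * norm (z 0) \<le> D * \<delta>"
      unfolding D_def sum_distrib_right using e(2)[OF z0] comp sum_mono order_trans by meson
    then have "(e * norm (z 0))\<^sup>2 \<le> (D * \<delta>)\<^sup>2"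
      using e(1) by (intro power_mono) auto
    then have "(D\<^sup>2 + e\<^sup>2) * (norm (z N))\<^sup>2 \<le> D\<^sup>2 * (norm (z 0))\<^sup>2 + e\<^sup>2 * ((norm (z N))\<^sup>2 - (norm (z 0))\<^sup>2)"
      by (simp add: power_mult_distrib \<delta>2 algebra_simps)
    also have "\<dots> \<le> D\<^sup>2 * (norm (z 0))\<^sup>2"
      using mono[of 0 N] by (simp add: mult_nonneg_nonpos)
    finally have "(norm (z N))\<^sup>2 \<le> (q * norm (z 0))\<^sup>2"
      using pos by (simp add: q_def power_mult_distrib field_simps)
    then show ?thesis by (rule power2_le_imp_le) (use pos in \<open>simp add: q_def\<close>)
  qed
  moreover have "0 \<le> q" "q < 1" using pos e(1) by (simp_all add: q_def)
  ultimately show ?thesis using that by blast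
qed

section \<open>Convergence to 0 under vanishing perturbations\<close>

text \<open>Once \<epsilon> is below \<eta> (1 - q), the excess of \<open>a\<close> over \<eta>
  shrinks by \<open>q\<close> every \<open>N\<close> indices, hence geometrically along each residue
  class modulo \<open>N\<close>.\<close>

lemma tendsto_zero_of_block_contraction:
  fixes a \<epsilon> :: "nat \<Rightarrow> real"
  assumes q: "0 \<le> q" "q < 1" and "0 < N"
    and nonneg: "\<And>k. 0 \<le> a k"
    and block: "\<And>k. a (k + N) \<le> q * a k + \<epsilon> k"
    and \<epsilon>: "\<epsilon> \<longlonglongrightarrow> 0"
  shows "a \<longlonglongrightarrow> 0"
proof (rule LIMSEQ_I)
  fix r :: real assume "0 < r"
  define \<eta> where "\<eta> = r / 2"
  have "0 < \<eta>" "\<eta> < r" using \<open>0 < r\<close> by (simp_all add: \<eta>_def)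
  then obtain K where K: "\<And>k. k \<ge> K \<Longrightarrow> \<epsilon> k < \<eta> * (1 - q)"
    using order_tendstoD(2)[OF \<epsilon>, of "\<eta> * (1 - q)"] q by (auto simp: eventually_sequentially)
  \<comment> \<open>\<open>M\<close> bounds the initial excess in all \<open>N\<close> residue
    classes at once; every index from \<open>K\<close> on has the form K + l + p N with l <
    N.\<close>
  define M where "M = Max (insert 0 ((\<lambda>k. a (K + k) - \<eta>) ` {..<N}))"
  have pow: "a (K + l + p * N) - \<eta> \<le> q ^ p * M" if "l < N" for l p
  proof (induction p)
    case 0
    then show ?case using that by (simp add: M_def)
  next
    case (Suc p)
    have "a (K + l + Suc p * N) - \<eta> \<le> q * (a (K + l + p * N) - \<eta>)"
      using block[of "K + l + p * N"] K[of "K + l + p * N"] by (simp add: algebra_simps)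
    also have "\<dots> \<le> q * (q ^ p * M)" using Suc q by (intro mult_left_mono) auto
    finally show ?case by simp
  qed
  have "(\<lambda>p. q ^ p * M) \<longlonglongrightarrow> 0"
    using q by (intro tendsto_mult_left_zero LIMSEQ_realpow_zero) auto
  then obtain P where P: "\<And>p. p \<ge> P \<Longrightarrow> q ^ p * M < r - \<eta>"
    using order_tendstoD(2)[of _ 0 _ "r - \<eta>"] \<open>\<eta> < r\<close> by (fastforce simp: eventually_sequentially)
  have "norm (a n - 0) < r" if "n \<ge> K + P * N" for n
  proof -
    have "P \<le> (n - K) div N" using that \<open>0 < N\<close> by (simp add: less_eq_div_iff_mult_less_eq)
    moreover have "n = K + (n - K) mod N + (n - K) div N * N" using that by simp
    ultimately have "a n - \<eta> < r - \<eta>"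
      using pow[of "(n - K) mod N" "(n - K) div N"] P \<open>0 < N\<close> by force
    then show ?thesis using nonneg[of n] by simp
  qed
  then show "\<exists>no. \<forall>n\<ge>no. norm (a n - 0) < r" by blast
qed

text \<open>Each block is compared with the exact iteration \<open>w\<close> restarted at its first
  iterate: \<open>w\<close> contracts by \<open>q\<close>, and by nonexpansiveness the deviation
  from \<open>w\<close> is at most the sum of the errors in the block.\<close>

lemma perturbed_relaxed_proj_tendsto_zero:
  fixes v :: "'i::finite \<Rightarrow> 'a::euclidean_space" and z e :: "nat \<Rightarrow> 'a"
  assumes \<omega>: "0 < \<omega>" "\<omega> < 2"
    and cyclic: "almost_cyclic s"
    and z0: "z 0 \<in> span (range v)"
    and z: "\<And>k. z (Suc k) = relaxed_proj \<omega> (v (s (Suc k))) (z k) + e k"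
    and e_span: "\<And>k. e k \<in> span (range v)"
    and e: "e \<longlonglongrightarrow> 0"
  shows "z \<longlonglongrightarrow> 0"
proof -
  obtain N where N: "\<And>k. UNIV \<subseteq> s ` {k + 1..k + N}"
    using cyclic by (auto simp: almost_cyclic_def)
  obtain q where q: "0 \<le> q" "q < 1" and
    contr: "\<And>s z. \<lbrakk>UNIV \<subseteq> s ` {..<N}; z 0 \<in> span (range v);
        \<And>k. z (Suc k) = relaxed_proj \<omega> (v (s k)) (z k)\<rbrakk> \<Longrightarrow> norm (z N) \<le> q * norm (z 0)"
    using relaxed_proj_block_contraction[OF \<omega>, where v = v and N = N] by blast
  have span: "z k \<in> span (range v)" for k
    by (induction k)
      (simp_all add: z0 z span_add e_span relaxed_proj_in_subspace span_base)
  define \<epsilon> where "\<epsilon> k = (\<Sum>l<N. norm (e (k + l)))" for k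
  have block: "norm (z (k + N)) \<le> q * norm (z k) + \<epsilon> k" for k
  proof -
    define w where "w = rec_nat (z k) (\<lambda>l u. relaxed_proj \<omega> (v (s (Suc (k + l)))) u)"
    have w: "w 0 = z k" "w (Suc l) = relaxed_proj \<omega> (v (s (Suc (k + l)))) (w l)" for l
      by (simp_all add: w_def)
    \<comment> \<open>The step leaving \<open>z k\<close> uses \<open>s (Suc k)\<close>, so the
      \<open>N\<close> steps from \<open>z k\<close> use exactly the window k+1..k+N of the
      cyclicity condition.\<close>
    have "{k + 1..k + N} = (\<lambda>l. Suc (k + l)) ` {..<N}"
      using image_Suc_atLeastLessThan[of k "k + N"] image_add_atLeastLessThan[of k 0 N]
      by (force simp: image_iff Bex_def less_iff_Suc_add le_iff_add)
    then have "UNIV \<subseteq> (\<lambda>l. s (Suc (k + l))) ` {..<N}"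
      using N[of k] by (simp add: image_image)
    then have "norm (w N) \<le> q * norm (z k)"
      using contr[of "\<lambda>l. s (Suc (k + l))" w] w span by simp
    moreover have "norm (z (k + l) - w l) \<le> (\<Sum>t<l. norm (e (k + t)))" for l
    proof (induction l)
      case (Suc l)
      have "z (k + Suc l) - w (Suc l)
          = relaxed_proj \<omega> (v (s (Suc (k + l)))) (z (k + l) - w l) + e (k + l)"
        by (simp add: z w relaxed_proj_diff)
      also have "norm \<dots> \<le> norm (z (k + l) - w l) + norm (e (k + l))"
        by (intro norm_triangle_mono norm_relaxed_proj_le[OF \<omega>] order_refl)
      finally show ?case using Suc by simp
    qed (simp add: w)
    then have "norm (z (k + N) - w N) \<le> \<epsilon> k" by (simp add: \<epsilon>_def)
    ultimately show ?thesis using norm_triangle_sub[of "z (k + N)" "w N"] by simp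
  qed
  have "\<epsilon> \<longlonglongrightarrow> (\<Sum>l<N. 0)"
    unfolding \<epsilon>_def by (intro tendsto_sum LIMSEQ_ignore_initial_segment tendsto_norm_zero e)
  then have "\<epsilon> \<longlonglongrightarrow> 0" by simp
  have "(\<lambda>k. norm (z k)) \<longlonglongrightarrow> 0"
  proof (rule tendsto_zero_of_block_contraction[where q = q and N = N and \<epsilon> = \<epsilon>])
    show "0 < N" using N[of 0] by (intro gr0I) auto
  qed (use q block \<open>\<epsilon> \<longlonglongrightarrow> 0\<close> in auto)
  then show ?thesis by (simp add: tendsto_norm_zero_iff)
qed

section \<open>Convergence of the two coupled iterations\<close>

theorem theorem4p4:
  fixes A :: "real^'n^'m" and b :: "real^'m" and \<alpha> \<omega> :: real
    and i :: "nat \<Rightarrow> 'm" and j :: "nat \<Rightarrow> 'n"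
    and x0 :: "real^'n" and x :: "nat \<Rightarrow> real^'n" and y bh :: "nat \<Rightarrow> real^'m"
  assumes "\<And>r. row r A \<noteq> 0"
    and "\<And>c. column c A \<noteq> 0"
    and "\<alpha> \<in> {0<..<2}"
    and "\<omega> \<in> {0<..<2}"
    and "ACEK A b \<alpha> \<omega> i j x0 x y bh"
  shows "\<exists>xs \<in> LSS A b. x \<longlonglongrightarrow> xs"
proof -
  let ?R = "range ((*v) A)"
  have cyc: "almost_cyclic i" "almost_cyclic j" and init: "x 0 = x0" "y 0 = b"
    and y: "\<And>k. y (Suc k) = relaxed_proj \<alpha> (column (j (Suc k)) A) (y k)"
    and x: "\<And>k. x (Suc k) = x k - (\<omega> * ((x k \<bullet> row (i (Suc k)) A - (b - y (Suc k)) $ i (Suc k))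
          / (norm (row (i (Suc k)) A))\<^sup>2)) *\<^sub>R row (i (Suc k)) A"
    using assms(5) by (auto simp: ACEK_def relaxed_proj_def)
  have sub: "subspace ?R" by (simp add: linear_subspace_image)
  define p where "p = orth_proj ?R b"
  have p: "p \<in> ?R" "b - p \<in> ?R\<^sup>\<bottom>" using orth_proj[OF sub, of b] by (simp_all add: p_def)
  have span_columns: "span (range (\<lambda>c. column c A)) = ?R"
    
  proof
    show "span (range (\<lambda>c. column c A)) \<subseteq> ?R"
      using sub by (intro span_minimal) (auto simp: matrix_vector_mult_basis[symmetric])
    show "?R \<subseteq> span (range (\<lambda>c. column c A))"
      using matrix_vector_mult_in_columnspace[of A]
      by (auto simp: columns_def full_SetCompr_eq)
  qed
  have y_lim: "y \<longlonglongrightarrow> b - p"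
  proof -
    \<comment> \<open>Since b - p is a common fixed point of all column steps, y - (b - p) is an
      exact iteration; it starts at \<open>p\<close>, which lies in the span of the columns.\<close>
    have fixed: "relaxed_proj \<alpha> (column c A) (b - p) = b - p" for c
    proof -
      have "column c A \<in> ?R" unfolding span_columns[symmetric] by (auto intro: span_base)
      then have "(b - p) \<bullet> column c A = 0"
        using p(2) by (auto simp: orthogonal_comp_def orthogonal_def inner_commute)
      then show ?thesis by (simp add: relaxed_proj_def)
    qed
    have "(\<lambda>k. y k - (b - p)) \<longlonglongrightarrow> 0"
    proof (rule perturbed_relaxed_proj_tendsto_zero[where v = "\<lambda>c. column c A" and e = "\<lambda>_. 0"
          and \<omega> = \<alpha> and s = j])
      show "y (Suc k) - (b - p)
          = relaxed_proj \<alpha> (column (j (Suc k)) A) (y k - (b - p)) + 0" for k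
        by (simp only: y fixed relaxed_proj_diff[where w = "b - p"] add_0_right)
    qed (use assms(3) cyc(2) p(1) in \<open>simp_all add: span_columns init subspace_0[OF sub]\<close>)
    then show ?thesis by (rule LIM_zero_cancel)
  qed
  obtain w where w: "A *v w = p" using p(1) by auto
  \<comment> \<open>Row steps never change the component orthogonal to the rows, so the limit must
    inherit \<open>n\<close> from \<open>x0\<close>. As \<open>A\<close> annihilates
    \<open>n\<close>, w + n is still a solution, and x0 - (w + n) = u lies in the row space.\<close>
  obtain u n where u: "u \<in> span (range (\<lambda>r. row r A))"
    and n: "\<And>t. t \<in> span (range (\<lambda>r. row r A)) \<Longrightarrow> orthogonal n t" and un: "x0 - w = u + n"
    using orthogonal_subspace_decomp_exists[of "range (\<lambda>r. row r A)" "x0 - w"] by metis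
  define xs where "xs = w + n"
  have mult_row: "(A *v t) $ r = t \<bullet> row r A" for t r
    by (simp add: matrix_mult_dot row_def vec_lambda_eta inner_commute)
  have "A *v n = 0"
    using n[OF span_base[OF rangeI]] by (simp add: vec_eq_iff mult_row orthogonal_def)
  then have xs: "A *v xs = p" by (simp add: xs_def w matrix_vector_right_distrib)
  \<comment> \<open>Because p = A xs, the residual in the update of \<open>x\<close> splits into
    that of the homogeneous iteration for x - xs and the deviation of \<open>y\<close> from its
    limit. The index \<open>Suc k\<close> reflects that \<open>x\<close> is updated with the new
    \<open>y\<close>.\<close>
  define e where "e k = - (\<omega> * ((y (Suc k) - (b - p)) $ i (Suc k) / (norm (row (i (Suc k)) A))\<^sup>2))
    *\<^sub>R row (i (Suc k)) A" for k
  have "(\<lambda>k. x k - xs) \<longlonglongrightarrow> 0"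
  proof (rule perturbed_relaxed_proj_tendsto_zero[where v = "\<lambda>r. row r A" and e = e
        and \<omega> = \<omega> and s = i])
    show "x 0 - xs \<in> span (range (\<lambda>r. row r A))"
      using u un by (simp add: xs_def init algebra_simps)
  next
    fix k
    have "p $ i (Suc k) = xs \<bullet> row (i (Suc k)) A" using xs mult_row by metis
    then have "\<omega> * ((x k \<bullet> row (i (Suc k)) A - (b - y (Suc k)) $ i (Suc k)) / (norm (row (i (Suc k)) A))\<^sup>2)
        = \<omega> * (((x k - xs) \<bullet> row (i (Suc k)) A) / (norm (row (i (Suc k)) A))\<^sup>2)
          + \<omega> * ((y (Suc k) - (b - p)) $ i (Suc k) / (norm (row (i (Suc k)) A))\<^sup>2)"
      unfolding distrib_left[symmetric] add_divide_distrib[symmetric] by (simp add: inner_diff_left)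
    then show "x (Suc k) - xs = relaxed_proj \<omega> (row (i (Suc k)) A) (x k - xs) + e k"
      unfolding x e_def relaxed_proj_def by (simp only: scaleR_left_distrib scaleR_minus_left) simp
  next
    show "e k \<in> span (range (\<lambda>r. row r A))" for k
      unfolding e_def by (intro span_scale span_base) simp
  next
    \<comment> \<open>The active row varies with \<open>k\<close>; summing over all rows gives one
      constant for every \<open>k\<close>.\<close>
    define B where "B = (\<Sum>r\<in>UNIV. \<omega> / norm (row r A))"
    have bound: "norm (e k) \<le> B * norm (y (Suc k) - (b - p))" for k
    proof -
      have "norm (e k) = \<omega> / norm (row (i (Suc k)) A) * \<bar>(y (Suc k) - (b - p)) $ i (Suc k)\<bar>"
        using assms(4) by (simp add: e_def abs_mult power2_eq_square)
      also have "\<dots> \<le> B * norm (y (Suc k) - (b - p))"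
        unfolding B_def using assms(4)
        by (intro mult_mono component_le_norm_cart member_le_sum sum_nonneg) auto
      finally show ?thesis .
    qed
    have "(\<lambda>k. B * norm (y (Suc k) - (b - p))) \<longlonglongrightarrow> 0"
      using LIMSEQ_Suc[OF y_lim]
      by (intro tendsto_mult_right_zero tendsto_norm_zero) (rule LIM_zero)
    then show "e \<longlonglongrightarrow> 0"
      by (rule Lim_null_comparison[rotated]) (simp add: bound)
  qed (use assms(4) cyc in auto)
  then have "x \<longlonglongrightarrow> xs" by (rule LIM_zero_cancel)
  with xs show ?thesis by (auto simp: LSS_def p_def)
qed

end
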